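(* Given $(=I^{nG})$ and $(=E)$, the terms $t$ and $u$ in $(\iota I)$, $(\iota E_1)$ and $(\iota E_2)$ can be restricted to atomic terms: in the system $S$ obtained from $\mathbf{INF}^{\iota}$ by adding the rule $(=I^{nG})$, whenever there is a deduction of a formula $A$ from open assumptions among $\Gamma$, there is a deduction in $S$ of $A$ from open assumptions among $\Gamma$ in which the term $t$ in every application of $(\iota I)$ and the terms $t$ and $u$ in every application of $(\iota E_1)$ and $(\iota E_2)$ are atomic.
   Context: **Language.** First-order language with parameters $a,b,\ldots$ (used as free variables, distinct in shape from the bound variables $x,y,z,\ldots$), constants, predicate letters, identity $=$, a one-place existence predicate $\exists!$, the connectives and quantifiers $\bot,\land,\lor,\rightarrow,\exists,\forall$, and the definite description operator $\iota$, which forms from a variable $x$ and a formula $F$ a term $\iota xF$ binding $x$; $\neg A$ is $A\rightarrow\bot$. Terms are parameters and constants (atomic terms) and $\iota$-terms (complex terms). $A_t^x$ is $A$ with $t$ replacing all free occurrences of $x$. **Rules of $\mathbf{INF}^{\iota}$** (natural deduction trees, $[A]$ marks a class of assumptions discharged by the rule, vacuous discharge allowed). $(\land I)$: from $A$, $B$ infer $A\land B$. $(\land E)$: from $A\land B$ infer $A$; from $A\land B$ infer $B$. $(\rightarrow I)$: from a deduction of $B$ from $[A]$ infer $A\rightarrow B$. $(\rightarrow E)$: from $A\rightarrow B$ and $A$ infer $B$. $(\lor I)$: from $A$ infer $A\lor B$; from $B$ infer $A\lor B$. $(\lor E)$: from $A\lor B$, a deduction of $C$ from $[A]$ and a deduction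 of $C$ from $[B]$ infer $C$. $(\bot E)$: from $\bot$ infer $B$. $(\forall I)$: from a deduction $\Pi$ of $A_a^x$ from $[\exists!a]$ infer $\forall xA$, where $a$ does not occur in $\forall xA$ nor in undischarged assumptions of $\Pi$ except those in the class of $\exists!a$. $(\forall E)$: from $\forall xA$ and $\exists!t$ infer $A_t^x$. $(\exists I)$: from $A_t^x$ and $\exists!t$ infer $\exists xA$. $(\exists E)$: from $\exists xA$ and a deduction $\Pi$ of $C$ from $[A_a^x],[\exists!a]$ infer $C$, where $a$ does not occur in $C$, in $\exists xA$, nor in undischarged assumptions of $\Pi$ except those in the classes of $A_a^x$ and $\exists!a$. $(=I^n)$: from $\exists!t$ infer $t=t$. $(=E)$: from $t_1=t_2$ and $A_{t_1}^x$ infer $A_{t_2}^x$. $(AD)$: from $Rt_1\ldots t_n$ infer $\exists!t_i$ ($1\le i\le n$), where $R$ is a predicate letter (not $\exists!$) or $=$. $(\iota I)$: from $\exists!t$, a deduction $\Xi$ of $F_a^x$ from $[a=t]$ and a deduction $\Pi$ of $a=t$ from $[F_a^x],[\exists!a]$ infer $\iota xF=t$, where $a$ does not occur in $\iota xF$, in $t$, nor in undischarged assumptions except those in the classes of $a=t$ in $\Xi$ and of $F_a^x$, $\exists!a$ in $\Pi$. $(\iota E_1)$: from $\iota xF=t$ and $u=t$ infer $F_u^x$. $(\iota E_2)$: from $\iota xF=t$, $F_u^x$ and $\exists!u$ infer $u=t$. $(\iota E_3)$: from $\iota xF=t$ infer $\exists!t$. **Rule $(=I^{nG})$**: from $\exists!t$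 and a deduction $\Pi$ of $C$ from $[a=t]$ infer $C$, where the parameter $a$ does not occur in $t$, $C$ nor in any open assumptions of $\Pi$ other than those in the class of $a=t$. *)

theory Defs
  imports Main
begin

text \<open>
  Bound variables (constructor \<open>Var\<close>) and parameters (constructor \<open>Par\<close>) are syntactically distinct,
  with countably many of each. Formulas are concrete strings: they are not identified up to renaming
  of bound variables. The types \<open>'c\<close> and \<open>'p\<close> are those of the constants and of the predicate
  letters; the arities of the latter are given by a function \<open>ar\<close>. The constructor \<open>Exist\<close> is the
  existence predicate and \<open>Exi\<close> the existential quantifier.
\<close>

datatype ('c, 'p) trm =
    Var nat
  | Par nat
  | Con 'c
  | Iota nat "('c, 'p) fm"
and ('c, 'p) fm =
    Falsum
  | Pred 'p "('c, 'p) trm list"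
  | Ident "('c, 'p) trm" "('c, 'p) trm"
  | Exist "('c, 'p) trm"
  | Conj "('c, 'p) fm" "('c, 'p) fm"
  | Disj "('c, 'p) fm" "('c, 'p) fm"
  | Impl "('c, 'p) fm" "('c, 'p) fm"
  | Exi nat "('c, 'p) fm"
  | Uni nat "('c, 'p) fm"

fun atomic :: "('c, 'p) trm \<Rightarrow> bool" where
  "atomic (Par a) = True"
| "atomic (Con c) = True"
| "atomic _ = False"

fun fv_trm :: "('c, 'p) trm \<Rightarrow> nat set" and fv :: "('c, 'p) fm \<Rightarrow> nat set" where
  "fv_trm (Var x) = {x}"
| "fv_trm (Par a) = {}"
| "fv_trm (Con c) = {}"
| "fv_trm (Iota x F) = fv F - {x}"
| "fv Falsum = {}"
| "fv (Pred R ts) = (\<Union>t\<in>set ts. fv_trm t)"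
| "fv (Ident s t) = fv_trm s \<union> fv_trm t"
| "fv (Exist t) = fv_trm t"
| "fv (Conj A B) = fv A \<union> fv B"
| "fv (Disj A B) = fv A \<union> fv B"
| "fv (Impl A B) = fv A \<union> fv B"
| "fv (Exi x A) = fv A - {x}"
| "fv (Uni x A) = fv A - {x}"

fun pars_trm :: "('c, 'p) trm \<Rightarrow> nat set" and pars :: "('c, 'p) fm \<Rightarrow> nat set" where
  "pars_trm (Var x) = {}"
| "pars_trm (Par a) = {a}"
| "pars_trm (Con c) = {}"
| "pars_trm (Iota x F) = pars F"
| "pars Falsum = {}"
| "pars (Pred R ts) = (\<Union>t\<in>set ts. pars_trm t)"
| "pars (Ident s t) = pars_trm s \<union> pars_trm t"
| "pars (Exist t) = pars_trm t"
| "pars (Conj A B) = pars A \<union> pars B"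
| "pars (Disj A B) = pars A \<union> pars B"
| "pars (Impl A B) = pars A \<union> pars B"
| "pars (Exi x A) = pars A"
| "pars (Uni x A) = pars A"

text \<open>
  \<open>sub x t A\<close> replaces all free occurrences of \<open>x\<close> in \<open>A\<close> by \<open>t\<close>. It does not rename bound variables;
  none can be captured, since the terms substituted in deductions have no free variables.
\<close>

fun sub_trm :: "nat \<Rightarrow> ('c, 'p) trm \<Rightarrow> ('c, 'p) trm \<Rightarrow> ('c, 'p) trm"
  and sub :: "nat \<Rightarrow> ('c, 'p) trm \<Rightarrow> ('c, 'p) fm \<Rightarrow> ('c, 'p) fm" where
  "sub_trm x t (Var y) = (if y = x then t else Var y)"
| "sub_trm x t (Par a) = Par a"
| "sub_trm x t (Con c) = Con c"
| "sub_trm x t (Iota y F) = (if y = x then Iota y F else Iota y (sub x t F))"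
| "sub x t Falsum = Falsum"
| "sub x t (Pred R ts) = Pred R (map (sub_trm x t) ts)"
| "sub x t (Ident r s) = Ident (sub_trm x t r) (sub_trm x t s)"
| "sub x t (Exist s) = Exist (sub_trm x t s)"
| "sub x t (Conj A B) = Conj (sub x t A) (sub x t B)"
| "sub x t (Disj A B) = Disj (sub x t A) (sub x t B)"
| "sub x t (Impl A B) = Impl (sub x t A) (sub x t B)"
| "sub x t (Exi y A) = (if y = x then Exi y A else Exi y (sub x t A))"
| "sub x t (Uni y A) = (if y = x then Uni y A else Uni y (sub x t A))"

fun arity_ok_trm :: "('p \<Rightarrow> nat) \<Rightarrow> ('c, 'p) trm \<Rightarrow> bool"
  and arity_ok :: "('p \<Rightarrow> nat) \<Rightarrow> ('c, 'p) fm \<Rightarrow> bool" where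
  "arity_ok_trm ar (Var x) = True"
| "arity_ok_trm ar (Par a) = True"
| "arity_ok_trm ar (Con c) = True"
| "arity_ok_trm ar (Iota x F) = arity_ok ar F"
| "arity_ok ar Falsum = True"
| "arity_ok ar (Pred R ts) = (length ts = ar R \<and> (\<forall>t\<in>set ts. arity_ok_trm ar t))"
| "arity_ok ar (Ident s t) = (arity_ok_trm ar s \<and> arity_ok_trm ar t)"
| "arity_ok ar (Exist t) = arity_ok_trm ar t"
| "arity_ok ar (Conj A B) = (arity_ok ar A \<and> arity_ok ar B)"
| "arity_ok ar (Disj A B) = (arity_ok ar A \<and> arity_ok ar B)"
| "arity_ok ar (Impl A B) = (arity_ok ar A \<and> arity_ok ar B)"
| "arity_ok ar (Exi x A) = arity_ok ar A"
| "arity_ok ar (Uni x A) = arity_ok ar A"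

text \<open>
  Parameters play the role of free variables, so the formulas that may stand in a deduction are those
  in which every occurrence of a variable is bound.
\<close>

definition formula :: "('p \<Rightarrow> nat) \<Rightarrow> ('c, 'p) fm \<Rightarrow> bool" where
  "formula ar A \<longleftrightarrow> fv A = {} \<and> arity_ok ar A"

text \<open>The terms \<open>t\<close> for which \<open>Exist t\<close> can be inferred by \<open>AD\<close> below.\<close>

fun args :: "('c, 'p) fm \<Rightarrow> ('c, 'p) trm list" where
  "args (Pred R ts) = ts"
| "args (Ident s t) = [s, t]"
| "args _ = []"

text \<open>
  Deduction trees. Each constructor is a rule, applied to the deductions of its premises in their
  usual order; \<open>EqIG\<close> is the rule added to the basic system. Assumption classes are identified by
  labels: \<open>Assm k A\<close> is an occurrence of the assumption \<open>A\<close> with label \<open>k\<close>, and a rule discharging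
  the class of \<open>A\<close> with label \<open>k\<close> in a subdeduction discharges all the assumptions \<open>Assm k A\<close> still
  open there, of which there may be none. The labels of the discharged classes stand immediately
  before the subdeduction in which they are discharged (in \<open>AllI\<close>, \<open>ExE\<close>, \<open>EqIG\<close> and \<open>IotaI\<close> the
  proper parameter of the rule precedes them).
\<close>

datatype ('c, 'p) ded =
    Assm nat "('c, 'p) fm"
  | ConjI "('c, 'p) ded" "('c, 'p) ded"
  | ConjE1 "('c, 'p) fm" "('c, 'p) fm" "('c, 'p) ded"
  | ConjE2 "('c, 'p) fm" "('c, 'p) fm" "('c, 'p) ded"
  | ImpI "('c, 'p) fm" nat "('c, 'p) ded"
  | ImpE "('c, 'p) fm" "('c, 'p) fm" "('c, 'p) ded" "('c, 'p) ded"
  | DisjI1 "('c, 'p) fm" "('c, 'p) fm" "('c, 'p) ded"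
  | DisjI2 "('c, 'p) fm" "('c, 'p) fm" "('c, 'p) ded"
  | DisjE "('c, 'p) fm" "('c, 'p) fm" "('c, 'p) fm" "('c, 'p) ded"
      nat "('c, 'p) ded" nat "('c, 'p) ded"
  | FalsumE "('c, 'p) fm" "('c, 'p) ded"
  | AllI nat "('c, 'p) fm" nat nat "('c, 'p) ded"
  | AllE nat "('c, 'p) fm" "('c, 'p) trm" "('c, 'p) ded" "('c, 'p) ded"
  | ExI nat "('c, 'p) fm" "('c, 'p) trm" "('c, 'p) ded" "('c, 'p) ded"
  | ExE nat "('c, 'p) fm" "('c, 'p) fm" "('c, 'p) ded" nat nat nat "('c, 'p) ded"
  | EqI "('c, 'p) trm" "('c, 'p) ded"
  | EqE nat "('c, 'p) fm" "('c, 'p) trm" "('c, 'p) trm" "('c, 'p) ded" "('c, 'p) ded"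
  | AD "('c, 'p) trm" "('c, 'p) ded"
  | IotaI nat "('c, 'p) fm" "('c, 'p) trm" "('c, 'p) ded"
      nat nat "('c, 'p) ded" nat nat "('c, 'p) ded"
  | IotaE1 nat "('c, 'p) fm" "('c, 'p) trm" "('c, 'p) trm" "('c, 'p) ded" "('c, 'p) ded"
  | IotaE2 nat "('c, 'p) fm" "('c, 'p) trm" "('c, 'p) trm"
      "('c, 'p) ded" "('c, 'p) ded" "('c, 'p) ded"
  | IotaE3 nat "('c, 'p) fm" "('c, 'p) trm" "('c, 'p) ded"
  | EqIG "('c, 'p) trm" "('c, 'p) fm" "('c, 'p) ded" nat nat "('c, 'p) ded"

primrec concl :: "('c, 'p) ded \<Rightarrow> ('c, 'p) fm" where
  "concl (Assm k A) = A"
| "concl (ConjI D E) = Conj (concl D) (concl E)"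
| "concl (ConjE1 A B D) = A"
| "concl (ConjE2 A B D) = B"
| "concl (ImpI A k D) = Impl A (concl D)"
| "concl (ImpE A B D E) = B"
| "concl (DisjI1 A B D) = Disj A B"
| "concl (DisjI2 A B D) = Disj A B"
| "concl (DisjE A B C D k E l G) = C"
| "concl (FalsumE B D) = B"
| "concl (AllI x A a k D) = Uni x A"
| "concl (AllE x A t D E) = sub x t A"
| "concl (ExI x A t D E) = Exi x A"
| "concl (ExE x A C D a k l E) = C"
| "concl (EqI t D) = Ident t t"
| "concl (EqE x A s t D E) = sub x t A"
| "concl (AD t D) = Exist t"
| "concl (IotaI x F t D a k E l m G) = Ident (Iota x F) t"
| "concl (IotaE1 x F t u D E) = sub x u F"
| "concl (IotaE2 x F t u D E G) = Ident u t"
| "concl (IotaE3 x F t D) = Exist t"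
| "concl (EqIG t C D a k E) = C"

primrec opens :: "('c, 'p) ded \<Rightarrow> (nat \<times> ('c, 'p) fm) set" where
  "opens (Assm k A) = {(k, A)}"
| "opens (ConjI D E) = opens D \<union> opens E"
| "opens (ConjE1 A B D) = opens D"
| "opens (ConjE2 A B D) = opens D"
| "opens (ImpI A k D) = opens D - {(k, A)}"
| "opens (ImpE A B D E) = opens D \<union> opens E"
| "opens (DisjI1 A B D) = opens D"
| "opens (DisjI2 A B D) = opens D"
| "opens (DisjE A B C D k E l G) = opens D \<union> (opens E - {(k, A)}) \<union> (opens G - {(l, B)})"
| "opens (FalsumE B D) = opens D"
| "opens (AllI x A a k D) = opens D - {(k, Exist (Par a))}"
| "opens (AllE x A t D E) = opens D \<union> opens E"
| "opens (ExI x A t D E) = opens D \<union> opens E"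
| "opens (ExE x A C D a k l E) =
     opens D \<union> (opens E - {(k, sub x (Par a) A), (l, Exist (Par a))})"
| "opens (EqI t D) = opens D"
| "opens (EqE x A s t D E) = opens D \<union> opens E"
| "opens (AD t D) = opens D"
| "opens (IotaI x F t D a k E l m G) =
     opens D \<union> (opens E - {(k, Ident (Par a) t)})
       \<union> (opens G - {(l, sub x (Par a) F), (m, Exist (Par a))})"
| "opens (IotaE1 x F t u D E) = opens D \<union> opens E"
| "opens (IotaE2 x F t u D E G) = opens D \<union> opens E \<union> opens G"
| "opens (IotaE3 x F t D) = opens D"
| "opens (EqIG t C D a k E) = opens D \<union> (opens E - {(k, Ident (Par a) t)})"

definition fresh_opens :: "nat \<Rightarrow> (nat \<times> ('c, 'p) fm) set \<Rightarrow> bool" where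
  "fresh_opens a H \<longleftrightarrow> (\<forall>(k, B)\<in>H. a \<notin> pars B)"

primrec rules_ok :: "('p \<Rightarrow> nat) \<Rightarrow> ('c, 'p) ded \<Rightarrow> bool" where
  "rules_ok ar (Assm k A) \<longleftrightarrow> formula ar A"
| "rules_ok ar (ConjI D E) \<longleftrightarrow> rules_ok ar D \<and> rules_ok ar E"
| "rules_ok ar (ConjE1 A B D) \<longleftrightarrow> rules_ok ar D \<and> concl D = Conj A B"
| "rules_ok ar (ConjE2 A B D) \<longleftrightarrow> rules_ok ar D \<and> concl D = Conj A B"
| "rules_ok ar (ImpI A k D) \<longleftrightarrow> rules_ok ar D \<and> formula ar A"
| "rules_ok ar (ImpE A B D E) \<longleftrightarrow>
     rules_ok ar D \<and> rules_ok ar E \<and> concl D = Impl A B \<and> concl E = A"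
| "rules_ok ar (DisjI1 A B D) \<longleftrightarrow> rules_ok ar D \<and> concl D = A \<and> formula ar B"
| "rules_ok ar (DisjI2 A B D) \<longleftrightarrow> rules_ok ar D \<and> concl D = B \<and> formula ar A"
| "rules_ok ar (DisjE A B C D k E l G) \<longleftrightarrow>
     rules_ok ar D \<and> rules_ok ar E \<and> rules_ok ar G \<and>
     concl D = Disj A B \<and> concl E = C \<and> concl G = C"
| "rules_ok ar (FalsumE B D) \<longleftrightarrow> rules_ok ar D \<and> concl D = Falsum \<and> formula ar B"
| "rules_ok ar (AllI x A a k D) \<longleftrightarrow>
     rules_ok ar D \<and> concl D = sub x (Par a) A \<and> formula ar (Uni x A) \<and>
     a \<notin> pars (Uni x A) \<and> fresh_opens a (opens D - {(k, Exist (Par a))})"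
| "rules_ok ar (AllE x A t D E) \<longleftrightarrow>
     rules_ok ar D \<and> rules_ok ar E \<and> concl D = Uni x A \<and> concl E = Exist t"
| "rules_ok ar (ExI x A t D E) \<longleftrightarrow>
     rules_ok ar D \<and> rules_ok ar E \<and> concl D = sub x t A \<and> concl E = Exist t \<and>
     formula ar (Exi x A)"
| "rules_ok ar (ExE x A C D a k l E) \<longleftrightarrow>
     rules_ok ar D \<and> rules_ok ar E \<and> concl D = Exi x A \<and> concl E = C \<and>
     a \<notin> pars C \<and> a \<notin> pars (Exi x A) \<and>
     fresh_opens a (opens E - {(k, sub x (Par a) A), (l, Exist (Par a))})"
| "rules_ok ar (EqI t D) \<longleftrightarrow> rules_ok ar D \<and> concl D = Exist t"
| "rules_ok ar (EqE x A s t D E) \<longleftrightarrow>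
     rules_ok ar D \<and> rules_ok ar E \<and> concl D = Ident s t \<and> concl E = sub x s A \<and>
     formula ar (sub x t A)"
| "rules_ok ar (AD t D) \<longleftrightarrow> rules_ok ar D \<and> t \<in> set (args (concl D))"
| "rules_ok ar (IotaI x F t D a k E l m G) \<longleftrightarrow>
     rules_ok ar D \<and> rules_ok ar E \<and> rules_ok ar G \<and>
     concl D = Exist t \<and> concl E = sub x (Par a) F \<and> concl G = Ident (Par a) t \<and>
     formula ar (Ident (Iota x F) t) \<and> a \<notin> pars_trm (Iota x F) \<and> a \<notin> pars_trm t \<and>
     fresh_opens a (opens D \<union> (opens E - {(k, Ident (Par a) t)})
       \<union> (opens G - {(l, sub x (Par a) F), (m, Exist (Par a))}))"
| "rules_ok ar (IotaE1 x F t u D E) \<longleftrightarrow>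
     rules_ok ar D \<and> rules_ok ar E \<and> concl D = Ident (Iota x F) t \<and> concl E = Ident u t"
| "rules_ok ar (IotaE2 x F t u D E G) \<longleftrightarrow>
     rules_ok ar D \<and> rules_ok ar E \<and> rules_ok ar G \<and>
     concl D = Ident (Iota x F) t \<and> concl E = sub x u F \<and> concl G = Exist u"
| "rules_ok ar (IotaE3 x F t D) \<longleftrightarrow> rules_ok ar D \<and> concl D = Ident (Iota x F) t"
| "rules_ok ar (EqIG t C D a k E) \<longleftrightarrow>
     rules_ok ar D \<and> rules_ok ar E \<and> concl D = Exist t \<and> concl E = C \<and>
     a \<notin> pars_trm t \<and> a \<notin> pars C \<and> fresh_opens a (opens E - {(k, Ident (Par a) t)})"

definition deduction ::
    "('p \<Rightarrow> nat) \<Rightarrow> ('c, 'p) ded \<Rightarrow> ('c, 'p) fm set \<Rightarrow> ('c, 'p) fm \<Rightarrow> bool" where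
  "deduction ar D \<Gamma> A \<longleftrightarrow> rules_ok ar D \<and> concl D = A \<and> snd ` opens D \<subseteq> \<Gamma>"

primrec iota_atomic :: "('c, 'p) ded \<Rightarrow> bool" where
  "iota_atomic (Assm k A) \<longleftrightarrow> True"
| "iota_atomic (ConjI D E) \<longleftrightarrow> iota_atomic D \<and> iota_atomic E"
| "iota_atomic (ConjE1 A B D) \<longleftrightarrow> iota_atomic D"
| "iota_atomic (ConjE2 A B D) \<longleftrightarrow> iota_atomic D"
| "iota_atomic (ImpI A k D) \<longleftrightarrow> iota_atomic D"
| "iota_atomic (ImpE A B D E) \<longleftrightarrow> iota_atomic D \<and> iota_atomic E"
| "iota_atomic (DisjI1 A B D) \<longleftrightarrow> iota_atomic D"
| "iota_atomic (DisjI2 A B D) \<longleftrightarrow> iota_atomic D"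
| "iota_atomic (DisjE A B C D k E l G) \<longleftrightarrow> iota_atomic D \<and> iota_atomic E \<and> iota_atomic G"
| "iota_atomic (FalsumE B D) \<longleftrightarrow> iota_atomic D"
| "iota_atomic (AllI x A a k D) \<longleftrightarrow> iota_atomic D"
| "iota_atomic (AllE x A t D E) \<longleftrightarrow> iota_atomic D \<and> iota_atomic E"
| "iota_atomic (ExI x A t D E) \<longleftrightarrow> iota_atomic D \<and> iota_atomic E"
| "iota_atomic (ExE x A C D a k l E) \<longleftrightarrow> iota_atomic D \<and> iota_atomic E"
| "iota_atomic (EqI t D) \<longleftrightarrow> iota_atomic D"
| "iota_atomic (EqE x A s t D E) \<longleftrightarrow> iota_atomic D \<and> iota_atomic E"
| "iota_atomic (AD t D) \<longleftrightarrow> iota_atomic D"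
| "iota_atomic (IotaI x F t D a k E l m G) \<longleftrightarrow>
     atomic t \<and> iota_atomic D \<and> iota_atomic E \<and> iota_atomic G"
| "iota_atomic (IotaE1 x F t u D E) \<longleftrightarrow>
     atomic t \<and> atomic u \<and> iota_atomic D \<and> iota_atomic E"
| "iota_atomic (IotaE2 x F t u D E G) \<longleftrightarrow>
     atomic t \<and> atomic u \<and> iota_atomic D \<and> iota_atomic E \<and> iota_atomic G"
| "iota_atomic (IotaE3 x F t D) \<longleftrightarrow> iota_atomic D"
| "iota_atomic (EqIG t C D a k E) \<longleftrightarrow> iota_atomic D \<and> iota_atomic E"

end

theory Submission
  imports Defs
begin

text \<open>
  A complex term \<open>t\<close> in an application of one of the three rules is denoting: \<open>Exist t\<close> is a premise
  or follows by \<open>AD\<close>. So \<open>EqIG\<close> provides a fresh parameter \<open>b\<close> with \<open>b = t\<close>; the rule is applied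
  with \<open>b\<close> in place of \<open>t\<close>, and \<open>EqE\<close> translates its premises and its conclusion between \<open>b\<close> and \<open>t\<close>.
  The proper parameter of \<open>IotaI\<close> can be kept, and a premise \<open>a = t\<close> discharged in a subdeduction is
  replaced by \<open>a = b\<close> by a cut.
\<close>

section \<open>Substitution, parameters and well-formedness\<close>

text \<open>Closed terms are unaffected by substitution, so a variable can mark the place at which
  \<open>EqE\<close> rewrites an identity between closed terms.\<close>

lemma sub_fresh:
  shows "x \<notin> fv_trm s \<Longrightarrow> sub_trm x t s = s"
    and "x \<notin> fv A \<Longrightarrow> sub x t A = A"
  by (induction x t s and x t A rule: sub_trm_sub.induct) (auto simp: map_idI)

lemma fv_sub:
  shows "fv_trm t = {} \<Longrightarrow> fv_trm (sub_trm x t s) = fv_trm s - {x}"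
    and "fv_trm t = {} \<Longrightarrow> fv (sub x t A) = fv A - {x}"
  by (induction x t s and x t A rule: sub_trm_sub.induct) auto

lemma arity_ok_sub:
  shows "arity_ok_trm ar t \<Longrightarrow> arity_ok_trm ar s \<Longrightarrow> arity_ok_trm ar (sub_trm x t s)"
    and "arity_ok_trm ar t \<Longrightarrow> arity_ok ar A \<Longrightarrow> arity_ok ar (sub x t A)"
  by (induction x t s and x t A rule: sub_trm_sub.induct) auto

lemma finite_pars:
  fixes s :: "('c, 'p) trm" and A :: "('c, 'p) fm"
  shows "finite (pars_trm s)"
    and "finite (pars A)"
  by (induction s and A rule: pars_trm_pars.induct) auto

text \<open>Together with \<open>finite_pars\<close>, this leaves parameters fresh for all open
  assumptions of a given deduction.\<close>

lemma finite_opens: "finite (opens D)"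
  by (induction D) auto

lemma formula_sub:
  assumes "fv A \<subseteq> {x}" "arity_ok ar A" "formula ar (Exist t)"
  shows "formula ar (sub x t A)"
  using assms by (auto simp: formula_def fv_sub arity_ok_sub)

lemma formula_args:
  assumes "formula ar A" "t \<in> set (args A)"
  shows "formula ar (Exist t)"
  using assms by (cases A) (auto simp: formula_def)

text \<open>Only conclusions built by substitution or extracted by \<open>AD\<close> need an
  argument. In \<open>AllE\<close> and \<open>IotaE1\<close> the substituted term is closed because
  it occurs in the conclusion of another premise.\<close>

lemma formula_concl: "rules_ok ar D \<Longrightarrow> formula ar (concl D)"
proof (induction D)
  case (AllE x A t D E)
  then show ?case by (simp add: formula_def fv_sub arity_ok_sub)
next
  case (IotaE1 x F t u D E)
  then show ?case by (simp add: formula_def fv_sub arity_ok_sub)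
next
  case (AD t D)
  then show ?case by (auto intro: formula_args)
qed (auto simp: formula_def)

section \<open>Provability by deductions with atomic iota rules, and its closure under the other
  rules\<close>

text \<open>
  Giving all the assumptions the label \<open>0\<close> merges assumption classes, so that more is discharged than
  before; as undischarged assumptions only restrict the rules, this does no harm.
\<close>

definition prv :: "('p \<Rightarrow> nat) \<Rightarrow> ('c, 'p) fm set \<Rightarrow> ('c, 'p) fm \<Rightarrow> bool" where
  "prv ar \<Gamma> A \<longleftrightarrow>
     (\<exists>D. rules_ok ar D \<and> iota_atomic D \<and> concl D = A \<and> opens D \<subseteq> {0} \<times> \<Gamma>)"

lemma prvI:
  assumes "rules_ok ar D" "iota_atomic D" "concl D = A" "opens D \<subseteq> {0} \<times> \<Gamma>"
  shows "prv ar \<Gamma> A"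
  using assms unfolding prv_def by blast

lemma prvE:
  assumes "prv ar \<Gamma> A"
  obtains D where "rules_ok ar D" "iota_atomic D" "concl D = A" "opens D \<subseteq> {0} \<times> \<Gamma>"
  using assms unfolding prv_def by blast

text \<open>The same deduction serves: freshness conditions concern its actual open assumptions, not
  the context that bounds them.\<close>

lemma prv_mono: "prv ar \<Gamma> A \<Longrightarrow> \<Gamma> \<subseteq> \<Delta> \<Longrightarrow> prv ar \<Delta> A"
  unfolding prv_def by blast

lemma prv_formula: "prv ar \<Gamma> A \<Longrightarrow> formula ar A"
  using formula_concl by (auto simp: prv_def)

lemma prv_Assm: "A \<in> \<Gamma> \<Longrightarrow> formula ar A \<Longrightarrow> prv ar \<Gamma> A"
  by (rule prvI[of _ "Assm 0 A"]) auto

lemma prv_ConjI: "prv ar \<Gamma> A \<Longrightarrow> prv ar \<Gamma> B \<Longrightarrow> prv ar \<Gamma> (Conj A B)"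
  apply (elim prvE)
  subgoal for D E by (rule prvI[of _ "ConjI D E"]) auto
  done

lemma prv_ConjE1: "prv ar \<Gamma> (Conj A B) \<Longrightarrow> prv ar \<Gamma> A"
  by (elim prvE, rule prvI[of _ "ConjE1 A B _"]) auto

lemma prv_ConjE2: "prv ar \<Gamma> (Conj A B) \<Longrightarrow> prv ar \<Gamma> B"
  by (elim prvE, rule prvI[of _ "ConjE2 A B _"]) auto

lemma prv_ImpI: "prv ar (insert A \<Gamma>) B \<Longrightarrow> formula ar A \<Longrightarrow> prv ar \<Gamma> (Impl A B)"
  by (elim prvE, rule prvI[of _ "ImpI A 0 _"]) auto

lemma prv_ImpE: "prv ar \<Gamma> (Impl A B) \<Longrightarrow> prv ar \<Gamma> A \<Longrightarrow> prv ar \<Gamma> B"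
  apply (elim prvE)
  subgoal for D E by (rule prvI[of _ "ImpE A B D E"]) auto
  done

text \<open>A detour through an implication avoids grafting one deduction onto the leaves of
  another.\<close>

lemma prv_cut: "prv ar (insert A \<Gamma>) B \<Longrightarrow> prv ar \<Gamma> A \<Longrightarrow> prv ar \<Gamma> B"
  by (rule prv_ImpE[OF prv_ImpI]) (auto dest: prv_formula)

lemma prv_DisjI1: "prv ar \<Gamma> A \<Longrightarrow> formula ar B \<Longrightarrow> prv ar \<Gamma> (Disj A B)"
  by (elim prvE, rule prvI[of _ "DisjI1 A B _"]) auto

lemma prv_DisjI2: "prv ar \<Gamma> B \<Longrightarrow> formula ar A \<Longrightarrow> prv ar \<Gamma> (Disj A B)"
  by (elim prvE, rule prvI[of _ "DisjI2 A B _"]) auto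

lemma prv_DisjE:
  assumes "prv ar \<Gamma> (Disj A B)" "prv ar (insert A \<Gamma>) C" "prv ar (insert B \<Gamma>) C"
  shows "prv ar \<Gamma> C"
proof -
  obtain D E G where "rules_ok ar D" "iota_atomic D" "concl D = Disj A B" "opens D \<subseteq> {0} \<times> \<Gamma>"
    and "rules_ok ar E" "iota_atomic E" "concl E = C" "opens E \<subseteq> {0} \<times> insert A \<Gamma>"
    and "rules_ok ar G" "iota_atomic G" "concl G = C" "opens G \<subseteq> {0} \<times> insert B \<Gamma>"
    using assms by (elim prvE)
  then show ?thesis
    by (intro prvI[of _ "DisjE A B C D 0 E 0 G"]) auto
qed

lemma prv_FalsumE: "prv ar \<Gamma> Falsum \<Longrightarrow> formula ar B \<Longrightarrow> prv ar \<Gamma> B"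
  by (elim prvE, rule prvI[of _ "FalsumE B _"]) auto

lemma prv_AllI:
  assumes "prv ar (insert (Exist (Par a)) \<Gamma>) (sub x (Par a) A)" "formula ar (Uni x A)"
    "a \<notin> pars A" "\<forall>B\<in>\<Gamma>. a \<notin> pars B"
  shows "prv ar \<Gamma> (Uni x A)"
proof -
  obtain D where "rules_ok ar D" "iota_atomic D" "concl D = sub x (Par a) A"
    "opens D \<subseteq> {0} \<times> insert (Exist (Par a)) \<Gamma>"
    using assms(1) by (elim prvE)
  with assms show ?thesis
    by (intro prvI[of _ "AllI x A a 0 D"]) (auto simp: fresh_opens_def)
qed

lemma prv_AllE: "prv ar \<Gamma> (Uni x A) \<Longrightarrow> prv ar \<Gamma> (Exist t) \<Longrightarrow> prv ar \<Gamma> (sub x t A)"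
  apply (elim prvE)
  subgoal for D E by (rule prvI[of _ "AllE x A t D E"]) auto
  done

lemma prv_ExI:
  "prv ar \<Gamma> (sub x t A) \<Longrightarrow> prv ar \<Gamma> (Exist t) \<Longrightarrow> formula ar (Exi x A) \<Longrightarrow> prv ar \<Gamma> (Exi x A)"
  apply (elim prvE)
  subgoal for D E by (rule prvI[of _ "ExI x A t D E"]) auto
  done

text \<open>Two contexts are kept apart because the proper parameter may occur in assumptions of the
  major premise: \<open>a\<close> must be fresh for \<open>\<Delta>\<close>, not for
  \<open>\<Gamma>\<close>.\<close>

lemma prv_ExE:
  assumes "prv ar \<Gamma> (Exi x A)" "prv ar (insert (sub x (Par a) A) (insert (Exist (Par a)) \<Delta>)) C"
    "\<Delta> \<subseteq> \<Gamma>" "a \<notin> pars A" "a \<notin> pars C" "\<forall>B\<in>\<Delta>. a \<notin> pars B"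
  shows "prv ar \<Gamma> C"
proof -
  obtain D E where "rules_ok ar D" "iota_atomic D" "concl D = Exi x A" "opens D \<subseteq> {0} \<times> \<Gamma>"
    and "rules_ok ar E" "iota_atomic E" "concl E = C"
      "opens E \<subseteq> {0} \<times> insert (sub x (Par a) A) (insert (Exist (Par a)) \<Delta>)"
    using assms(1,2) by (elim prvE)
  with assms show ?thesis
    by (intro prvI[of _ "ExE x A C D a 0 0 E"]) (auto simp: fresh_opens_def)
qed

lemma prv_EqI: "prv ar \<Gamma> (Exist t) \<Longrightarrow> prv ar \<Gamma> (Ident t t)"
  by (elim prvE, rule prvI[of _ "EqI t _"]) auto

lemma prv_EqE:
  assumes "prv ar \<Gamma> (Ident s t)" "prv ar \<Gamma> (sub x s A)" "formula ar (sub x t A)"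
  shows "prv ar \<Gamma> (sub x t A)"
  using assms
  apply (elim prvE)
  subgoal for D E by (rule prvI[of _ "EqE x A s t D E"]) auto
  done

lemma prv_AD: "prv ar \<Gamma> A \<Longrightarrow> t \<in> set (args A) \<Longrightarrow> prv ar \<Gamma> (Exist t)"
  by (elim prvE, rule prvI[of _ "AD t _"]) auto

text \<open>The contexts are separated for the same reason as in \<open>prv_ExE\<close>.\<close>

lemma prv_EqIG:
  assumes "prv ar \<Gamma> (Exist t)" "prv ar (insert (Ident (Par a) t) \<Delta>) C"
    "\<Delta> \<subseteq> \<Gamma>" "a \<notin> pars_trm t" "a \<notin> pars C" "\<forall>B\<in>\<Delta>. a \<notin> pars B"
  shows "prv ar \<Gamma> C"
proof -
  obtain D E where "rules_ok ar D" "iota_atomic D" "concl D = Exist t" "opens D \<subseteq> {0} \<times> \<Gamma>"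
    and "rules_ok ar E" "iota_atomic E" "concl E = C"
      "opens E \<subseteq> {0} \<times> insert (Ident (Par a) t) \<Delta>"
    using assms(1,2) by (elim prvE)
  with assms show ?thesis
    by (intro prvI[of _ "EqIG t C D a 0 E"]) (auto simp: fresh_opens_def)
qed

section \<open>Identity and the naming of denoting terms\<close>

text \<open>\<open>EqE\<close> rewrites \<open>t\<close> to \<open>u\<close> at the hole
  \<open>Var 0\<close> of \<open>s = _\<close>; as \<open>s\<close> is closed, nothing else
  changes.\<close>

lemma prv_trans:
  assumes "prv ar \<Gamma> (Ident s t)" "prv ar \<Gamma> (Ident t u)"
  shows "prv ar \<Gamma> (Ident s u)"
proof -
  have "formula ar (Ident s u)" "fv_trm s = {}"
    using assms[THEN prv_formula] by (auto simp: formula_def)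
  then show ?thesis
    using prv_EqE[OF assms(2), of 0 "Ident s (Var 0)"] assms(1) by (simp add: sub_fresh)
qed

text \<open>Reflexivity holds only for denoting terms, but \<open>s = t\<close> yields
  \<open>Exist s\<close> by \<open>AD\<close>. In \<open>s = s\<close> the left-hand
  \<open>s\<close> is then rewritten to \<open>t\<close>.\<close>

lemma prv_sym:
  assumes "prv ar \<Gamma> (Ident s t)"
  shows "prv ar \<Gamma> (Ident t s)"
proof -
  have "formula ar (Ident t s)" "fv_trm s = {}"
    using assms[THEN prv_formula] by (auto simp: formula_def)
  moreover have "prv ar \<Gamma> (Ident s s)"
    using assms by (intro prv_EqI) (auto intro: prv_AD)
  ultimately show ?thesis
    using prv_EqE[OF assms, of 0 "Ident (Var 0) s"] by (simp add: sub_fresh)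
qed

text \<open>The step that makes complex terms dispensable: in proving \<open>C\<close>, a denoting
  \<open>t\<close> may be assumed to equal a parameter \<open>b\<close>. Finiteness of
  \<open>\<Gamma>\<close> guarantees a fresh \<open>b\<close>, and \<open>S\<close> collects further
  parameters to be avoided.\<close>

lemma prv_name:
  assumes "prv ar \<Gamma> (Exist t)" "finite \<Gamma>" "finite S"
    and "\<And>b. b \<notin> S \<Longrightarrow> prv ar (insert (Ident (Par b) t) \<Gamma>) (Ident (Par b) t) \<Longrightarrow>
      prv ar (insert (Ident (Par b) t) \<Gamma>) C"
  shows "prv ar \<Gamma> C"
proof -
  have "finite (S \<union> pars_trm t \<union> pars C \<union> (\<Union>B\<in>\<Gamma>. pars B))"
    using assms by (simp add: finite_pars)
  then obtain b where b: "b \<notin> S \<union> pars_trm t \<union> pars C \<union> (\<Union>B\<in>\<Gamma>. pars B)"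
    using ex_new_if_finite infinite_UNIV_nat by metis
  have "formula ar (Ident (Par b) t)"
    using prv_formula[OF assms(1)] by (simp add: formula_def)
  then have "prv ar (insert (Ident (Par b) t) \<Gamma>) (Ident (Par b) t)"
    by (simp add: prv_Assm)
  with b assms(1,4) show ?thesis
    by (intro prv_EqIG[of ar \<Gamma> t b \<Gamma> C]) auto
qed

section \<open>The iota rules for arbitrary terms\<close>

text \<open>The rule itself in its restricted form. One context suffices here, since its freshness
  condition concerns the open assumptions of all three subdeductions.\<close>

lemma prv_IotaI_Par:
  assumes "prv ar \<Gamma> (Exist (Par b))"
    and "prv ar (insert (Ident (Par a) (Par b)) \<Gamma>) (sub x (Par a) F)"
    and "prv ar (insert (sub x (Par a) F) (insert (Exist (Par a)) \<Gamma>)) (Ident (Par a) (Par b))"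
    and "formula ar (Exist (Iota x F))" "a \<notin> pars F" "a \<noteq> b" "\<forall>B\<in>\<Gamma>. a \<notin> pars B"
  shows "prv ar \<Gamma> (Ident (Iota x F) (Par b))"
proof -
  obtain D E G where "rules_ok ar D" "iota_atomic D" "concl D = Exist (Par b)"
      "opens D \<subseteq> {0} \<times> \<Gamma>"
    and "rules_ok ar E" "iota_atomic E" "concl E = sub x (Par a) F"
      "opens E \<subseteq> {0} \<times> insert (Ident (Par a) (Par b)) \<Gamma>"
    and "rules_ok ar G" "iota_atomic G" "concl G = Ident (Par a) (Par b)"
      "opens G \<subseteq> {0} \<times> insert (sub x (Par a) F) (insert (Exist (Par a)) \<Gamma>)"
    using assms(1-3) by (elim prvE)
  with assms(4-) show ?thesis
    by (intro prvI[of _ "IotaI x F (Par b) D a 0 E 0 0 G"])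
      (auto simp: fresh_opens_def formula_def)
qed

lemma prv_IotaI:
  assumes D: "prv ar \<Gamma> (Exist t)"
    and E: "prv ar (insert (Ident (Par a) t) \<Gamma>) (sub x (Par a) F)"
    and G: "prv ar (insert (sub x (Par a) F) (insert (Exist (Par a)) \<Gamma>)) (Ident (Par a) t)"
    and fm: "formula ar (Exist (Iota x F))" and fresh: "a \<notin> pars F" "a \<notin> pars_trm t"
    "\<forall>B\<in>\<Gamma>. a \<notin> pars B"
    and fin: "finite \<Gamma>"
  shows "prv ar \<Gamma> (Ident (Iota x F) t)"
\<comment> \<open>Avoiding \<open>a\<close> keeps it usable as proper parameter: it must differ from
  \<open>b\<close> and be absent from the new assumption \<open>b = t\<close>.\<close>
proof (rule prv_name[OF D fin, of "{a}"])
  fix b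
  let ?\<Delta> = "insert (Ident (Par b) t) \<Gamma>"
  assume "b \<notin> {a}" and bt: "prv ar ?\<Delta> (Ident (Par b) t)"
  have "prv ar ?\<Delta> (Ident (Iota x F) (Par b))"
  proof (rule prv_IotaI_Par)
    show "prv ar ?\<Delta> (Exist (Par b))"
      using bt by (rule prv_AD) simp
    show "prv ar (insert (Ident (Par a) (Par b)) ?\<Delta>) (sub x (Par a) F)"
    \<comment> \<open>The given derivation assumes \<open>a = t\<close>, which now follows from
      \<open>a = b\<close> and \<open>b = t\<close>.\<close>
    proof (rule prv_cut)
      show "prv ar (insert (Ident (Par a) t) (insert (Ident (Par a) (Par b)) ?\<Delta>)) (sub x (Par a) F)"
        using E by (rule prv_mono) blast
      show "prv ar (insert (Ident (Par a) (Par b)) ?\<Delta>) (Ident (Par a) t)"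
      proof (rule prv_trans)
        show "prv ar (insert (Ident (Par a) (Par b)) ?\<Delta>) (Ident (Par a) (Par b))"
          by (rule prv_Assm) (auto simp: formula_def)
        show "prv ar (insert (Ident (Par a) (Par b)) ?\<Delta>) (Ident (Par b) t)"
          using bt by (rule prv_mono) blast
      qed
    qed
    let ?\<Theta> = "insert (sub x (Par a) F) (insert (Exist (Par a)) ?\<Delta>)"
    show "prv ar ?\<Theta> (Ident (Par a) (Par b))"
    proof (rule prv_trans)
      show "prv ar ?\<Theta> (Ident (Par a) t)"
        using G by (rule prv_mono) blast
      show "prv ar ?\<Theta> (Ident t (Par b))"
        using prv_sym[OF bt] by (rule prv_mono) blast
    qed
  qed (use \<open>b \<notin> {a}\<close> fm fresh in auto)
  then show "prv ar ?\<Delta> (Ident (Iota x F) t)"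
    using bt by (rule prv_trans)
qed simp

lemma prv_IotaE1_Par:
  "prv ar \<Gamma> (Ident (Iota x F) (Par b)) \<Longrightarrow> prv ar \<Gamma> (Ident (Par c) (Par b)) \<Longrightarrow>
    prv ar \<Gamma> (sub x (Par c) F)"
  apply (elim prvE)
  subgoal for D E by (rule prvI[of _ "IotaE1 x F (Par b) (Par c) D E"]) auto
  done

text \<open>Both terms get names, \<open>b\<close> for \<open>t\<close> and \<open>c\<close> for
  \<open>u\<close>; the premise \<open>u = t\<close> shows by \<open>AD\<close> that both denote.
  The restricted rule gives the instance of \<open>F\<close> for \<open>c\<close>, which
  \<open>c = u\<close> turns into that for \<open>u\<close>.\<close>

lemma prv_IotaE1:
  assumes Ft: "prv ar \<Gamma> (Ident (Iota x F) t)" and ut: "prv ar \<Gamma> (Ident u t)" and fin: "finite \<Gamma>"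
  shows "prv ar \<Gamma> (sub x u F)"
proof (rule prv_name[OF _ fin finite.emptyI])
  show "prv ar \<Gamma> (Exist t)"
    using ut by (rule prv_AD) simp
next
  fix b
  let ?\<Delta> = "insert (Ident (Par b) t) \<Gamma>"
  assume bt: "prv ar ?\<Delta> (Ident (Par b) t)"
  show "prv ar ?\<Delta> (sub x u F)"
  proof (rule prv_name[OF _ _ finite.emptyI])
    have "prv ar \<Gamma> (Exist u)"
      using ut by (rule prv_AD) simp
    then show "prv ar ?\<Delta> (Exist u)"
      by (rule prv_mono) blast
    show "finite ?\<Delta>"
      using fin by simp
  next
    fix c
    let ?\<Theta> = "insert (Ident (Par c) u) ?\<Delta>"
    assume cu: "prv ar ?\<Theta> (Ident (Par c) u)"
    have tb: "prv ar ?\<Theta> (Ident t (Par b))"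
      using prv_sym[OF bt] by (rule prv_mono) blast
    have Fb: "prv ar ?\<Theta> (Ident (Iota x F) (Par b))"
      by (rule prv_trans[OF prv_mono[OF Ft] tb]) blast
    \<comment> \<open>The chain is \<open>c = u\<close>, \<open>u = t\<close>,
      \<open>t = b\<close>.\<close>
    have cb: "prv ar ?\<Theta> (Ident (Par c) (Par b))"
      by (rule prv_trans[OF prv_trans[OF cu prv_mono[OF ut]] tb]) blast
    have "prv ar ?\<Theta> (sub x (Par c) F)"
      using Fb cb by (rule prv_IotaE1_Par)
    moreover have "formula ar (sub x u F)"
      using Ft[THEN prv_formula] ut[THEN prv_formula]
      by (intro formula_sub) (auto simp: formula_def)
    ultimately show "prv ar ?\<Theta> (sub x u F)"
      by (rule prv_EqE[OF cu])
  qed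
qed

lemma prv_IotaE2_Par:
  "prv ar \<Gamma> (Ident (Iota x F) (Par b)) \<Longrightarrow> prv ar \<Gamma> (sub x (Par c) F) \<Longrightarrow>
    prv ar \<Gamma> (Exist (Par c)) \<Longrightarrow> prv ar \<Gamma> (Ident (Par c) (Par b))"
  apply (elim prvE)
  subgoal for D E G by (rule prvI[of _ "IotaE2 x F (Par b) (Par c) D E G"]) auto
  done

text \<open>The names are as in \<open>prv_IotaE1\<close>, but now \<open>t\<close> denotes by
  \<open>AD\<close> from the identity with the description, and \<open>u\<close> by a premise. The
  instance of \<open>F\<close> is moved from \<open>u\<close> to \<open>c\<close> before the
  restricted rule is applied.\<close>

lemma prv_IotaE2:
  assumes Ft: "prv ar \<Gamma> (Ident (Iota x F) t)" and Fu: "prv ar \<Gamma> (sub x u F)"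
    and u: "prv ar \<Gamma> (Exist u)" and fin: "finite \<Gamma>"
  shows "prv ar \<Gamma> (Ident u t)"
proof (rule prv_name[OF _ fin finite.emptyI])
  show "prv ar \<Gamma> (Exist t)"
    using Ft by (rule prv_AD) simp
next
  fix b
  let ?\<Delta> = "insert (Ident (Par b) t) \<Gamma>"
  assume bt: "prv ar ?\<Delta> (Ident (Par b) t)"
  show "prv ar ?\<Delta> (Ident u t)"
  proof (rule prv_name[OF _ _ finite.emptyI])
    show "prv ar ?\<Delta> (Exist u)"
      using u by (rule prv_mono) blast
    show "finite ?\<Delta>"
      using fin by simp
  next
    fix c
    let ?\<Theta> = "insert (Ident (Par c) u) ?\<Delta>"
    assume cu: "prv ar ?\<Theta> (Ident (Par c) u)"
    have bt': "prv ar ?\<Theta> (Ident (Par b) t)"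
      using bt by (rule prv_mono) blast
    have Fb: "prv ar ?\<Theta> (Ident (Iota x F) (Par b))"
      by (rule prv_trans[OF prv_mono[OF Ft] prv_sym[OF bt']]) blast
    have "formula ar (sub x (Par c) F)"
      using Ft[THEN prv_formula] by (intro formula_sub) (auto simp: formula_def)
    then have Fc: "prv ar ?\<Theta> (sub x (Par c) F)"
      by (rule prv_EqE[OF prv_sym[OF cu] prv_mono[OF Fu], rotated]) blast
    have c: "prv ar ?\<Theta> (Exist (Par c))"
      using cu by (rule prv_AD) simp
    have "prv ar ?\<Theta> (Ident (Par c) (Par b))"
      using Fb Fc c by (rule prv_IotaE2_Par)
    \<comment> \<open>The chain is \<open>u = c\<close>, \<open>c = b\<close>,
      \<open>b = t\<close>.\<close>
    then show "prv ar ?\<Theta> (Ident u t)"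
      by (rule prv_trans[OF prv_trans[OF prv_sym[OF cu]] bt'])
  qed
qed

section \<open>Translation of arbitrary deductions\<close>

text \<open>The context is exactly the set of open assumptions: it is finite, as naming requires,
  and the freshness conditions in \<open>rules_ok\<close> speak about it.\<close>

lemma prv_opens_concl: "rules_ok ar D \<Longrightarrow> prv ar (snd ` opens D) (concl D)"
proof (induction D)
  case (Assm k A)
  then show ?case by (simp add: prv_Assm)
next
  case (ConjI D E)
  let ?\<Gamma> = "snd ` opens (ConjI D E)"
  have "prv ar ?\<Gamma> (concl D)" "prv ar ?\<Gamma> (concl E)"
    using ConjI by (auto elim!: prv_mono)
  then show ?case by (simp add: prv_ConjI)
next
  case (ConjE1 A B D)
  then show ?case using prv_ConjE1[of ar "snd ` opens D" A B] by simp
next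
  case (ConjE2 A B D)
  then show ?case using prv_ConjE2[of ar "snd ` opens D" A B] by simp
next
  case (ImpI A k D)
  then have D: "prv ar (snd ` opens D) (concl D)" and A: "formula ar A"
    by auto
  \<comment> \<open>\<open>A\<close> may remain in the context under a label other than
    \<open>k\<close>; adding it covers the discharged class in either case.\<close>
  have "prv ar (insert A (snd ` opens (ImpI A k D))) (concl D)"
    by (rule prv_mono[OF D]) force
  then have "prv ar (snd ` opens (ImpI A k D)) (Impl A (concl D))"
    using A by (rule prv_ImpI)
  then show ?case by simp
next
  case (ImpE A B D E)
  let ?\<Gamma> = "snd ` opens (ImpE A B D E)"
  have "prv ar ?\<Gamma> (Impl A B)" "prv ar ?\<Gamma> A"
    using ImpE by (auto elim!: prv_mono)
  then have "prv ar ?\<Gamma> B"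
    by (rule prv_ImpE)
  then show ?case by simp
next
  case (DisjI1 A B D)
  then show ?case using prv_DisjI1[of ar "snd ` opens D" A B] by simp
next
  case (DisjI2 A B D)
  then show ?case using prv_DisjI2[of ar "snd ` opens D" B A] by simp
next
  case (DisjE A B C D k E l G)
  let ?\<Gamma> = "snd ` opens (DisjE A B C D k E l G)"
  have D: "prv ar (snd ` opens D) (Disj A B)" and E: "prv ar (snd ` opens E) C"
    and G: "prv ar (snd ` opens G) C"
    using DisjE by auto
  have "prv ar ?\<Gamma> (Disj A B)"
    by (rule prv_mono[OF D]) auto
  moreover have "prv ar (insert A ?\<Gamma>) C"
    by (rule prv_mono[OF E]) force
  moreover have "prv ar (insert B ?\<Gamma>) C"
    by (rule prv_mono[OF G]) force
  ultimately have "prv ar ?\<Gamma> C"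
    by (rule prv_DisjE)
  then show ?case by simp
next
  case (FalsumE B D)
  then show ?case using prv_FalsumE[of ar "snd ` opens D" B] by simp
next
  case (AllI x A a k D)
  let ?\<Gamma> = "snd ` opens (AllI x A a k D)"
  have D: "prv ar (snd ` opens D) (sub x (Par a) A)"
    using AllI by auto
  have "prv ar (insert (Exist (Par a)) ?\<Gamma>) (sub x (Par a) A)"
    by (rule prv_mono[OF D]) force
  then have "prv ar ?\<Gamma> (Uni x A)"
    by (rule prv_AllI) (use AllI.prems in \<open>auto simp: fresh_opens_def\<close>)
  then show ?case by simp
next
  case (AllE x A t D E)
  let ?\<Gamma> = "snd ` opens (AllE x A t D E)"
  have "prv ar ?\<Gamma> (Uni x A)" "prv ar ?\<Gamma> (Exist t)"
    using AllE by (auto elim!: prv_mono)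
  then have "prv ar ?\<Gamma> (sub x t A)"
    by (rule prv_AllE)
  then show ?case by simp
next
  case (ExI x A t D E)
  let ?\<Gamma> = "snd ` opens (ExI x A t D E)"
  have "prv ar ?\<Gamma> (sub x t A)" "prv ar ?\<Gamma> (Exist t)"
    using ExI by (auto elim!: prv_mono)
  then have "prv ar ?\<Gamma> (Exi x A)"
    by (rule prv_ExI) (use ExI.prems in simp)
  then show ?case by simp
next
  case (ExE x A C D a k l E)
  let ?\<Gamma> = "snd ` opens (ExE x A C D a k l E)"
  \<comment> \<open>Only these assumptions are known to be free of \<open>a\<close>; those of
    \<open>D\<close> need not be.\<close>
  let ?\<Delta> = "snd ` (opens E - {(k, sub x (Par a) A), (l, Exist (Par a))})"
  have D: "prv ar (snd ` opens D) (Exi x A)" and E: "prv ar (snd ` opens E) C"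
    using ExE by auto
  have "prv ar ?\<Gamma> (Exi x A)"
    by (rule prv_mono[OF D]) auto
  moreover have "prv ar (insert (sub x (Par a) A) (insert (Exist (Par a)) ?\<Delta>)) C"
    by (rule prv_mono[OF E]) force
  ultimately have "prv ar ?\<Gamma> C"
    by (rule prv_ExE) (use ExE.prems in \<open>auto simp: fresh_opens_def\<close>)
  then show ?case by simp
next
  case (EqI t D)
  then show ?case using prv_EqI[of ar "snd ` opens D" t] by simp
next
  case (EqE x A s t D E)
  let ?\<Gamma> = "snd ` opens (EqE x A s t D E)"
  have "prv ar ?\<Gamma> (Ident s t)" "prv ar ?\<Gamma> (sub x s A)"
    using EqE by (auto elim!: prv_mono)
  then have "prv ar ?\<Gamma> (sub x t A)"
    by (rule prv_EqE) (use EqE.prems in simp)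
  then show ?case by simp
next
  case (AD t D)
  then show ?case using prv_AD[of ar "snd ` opens D" "concl D" t] by simp
next
  case (IotaI x F t D a k E l m G)
  let ?\<Gamma> = "snd ` opens (IotaI x F t D a k E l m G)"
  have D: "prv ar (snd ` opens D) (Exist t)" and E: "prv ar (snd ` opens E) (sub x (Par a) F)"
    and G: "prv ar (snd ` opens G) (Ident (Par a) t)"
    using IotaI by auto
  have "prv ar ?\<Gamma> (Exist t)"
    by (rule prv_mono[OF D]) auto
  moreover have "prv ar (insert (Ident (Par a) t) ?\<Gamma>) (sub x (Par a) F)"
    by (rule prv_mono[OF E]) force
  moreover have "prv ar (insert (sub x (Par a) F) (insert (Exist (Par a)) ?\<Gamma>)) (Ident (Par a) t)"
    by (rule prv_mono[OF G]) force
  ultimately have "prv ar ?\<Gamma> (Ident (Iota x F) t)"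
  proof (rule prv_IotaI)
    show "finite ?\<Gamma>"
      by (intro finite_imageI finite_opens)
    show "\<forall>B\<in>?\<Gamma>. a \<notin> pars B"
    proof -
      have "fresh_opens a (opens (IotaI x F t D a k E l m G))"
        using IotaI.prems by simp
      then show ?thesis
        unfolding fresh_opens_def by (auto simp del: opens.simps)
    qed
  qed (use IotaI.prems in \<open>auto simp: formula_def\<close>)
  then show ?case by simp
next
  case (IotaE1 x F t u D E)
  let ?\<Gamma> = "snd ` opens (IotaE1 x F t u D E)"
  have "prv ar ?\<Gamma> (Ident (Iota x F) t)" "prv ar ?\<Gamma> (Ident u t)"
    using IotaE1 by (auto elim!: prv_mono)
  then have "prv ar ?\<Gamma> (sub x u F)"
    by (rule prv_IotaE1) (intro finite_imageI finite_opens)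
  then show ?case by simp
next
  case (IotaE2 x F t u D E G)
  let ?\<Gamma> = "snd ` opens (IotaE2 x F t u D E G)"
  have "prv ar ?\<Gamma> (Ident (Iota x F) t)" "prv ar ?\<Gamma> (sub x u F)" "prv ar ?\<Gamma> (Exist u)"
    using IotaE2 by (auto elim!: prv_mono)
  then have "prv ar ?\<Gamma> (Ident u t)"
    by (rule prv_IotaE2) (intro finite_imageI finite_opens)
  then show ?case by simp
next
  case (IotaE3 x F t D)
  \<comment> \<open>The premise is an identity with \<open>t\<close> on its right, so
    \<open>AD\<close> replaces \<open>IotaE3\<close>.\<close>
  then show ?case using prv_AD[of ar "snd ` opens D" "concl D" t] by simp
next
  case (EqIG t C D a k E)
  let ?\<Gamma> = "snd ` opens (EqIG t C D a k E)"
  let ?\<Delta> = "snd ` (opens E - {(k, Ident (Par a) t)})"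
  have D: "prv ar (snd ` opens D) (Exist t)" and E: "prv ar (snd ` opens E) C"
    using EqIG by auto
  have "prv ar ?\<Gamma> (Exist t)"
    by (rule prv_mono[OF D]) auto
  moreover have "prv ar (insert (Ident (Par a) t) ?\<Delta>) C"
    by (rule prv_mono[OF E]) force
  ultimately have "prv ar ?\<Gamma> C"
    by (rule prv_EqIG) (use EqIG.prems in \<open>auto simp: fresh_opens_def\<close>)
  then show ?case by simp
qed

theorem lemma8:
  fixes ar :: "'p \<Rightarrow> nat" and \<Gamma> :: "('c, 'p) fm set" and A :: "('c, 'p) fm"
  assumes "\<exists>D. deduction ar D \<Gamma> A"
  shows "\<exists>D. deduction ar D \<Gamma> A \<and> iota_atomic D"
proof -
  from assms obtain D where "rules_ok ar D" "concl D = A" "snd ` opens D \<subseteq> \<Gamma>"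
    unfolding deduction_def by blast
  \<comment> \<open>Weakening to the possibly infinite \<open>\<Gamma>\<close> comes only after all
    fresh parameters have been chosen.\<close>
  then have "prv ar \<Gamma> A"
    using prv_opens_concl prv_mono by metis
  then show ?thesis
    by (elim prvE) (force simp: deduction_def)
qed

end
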